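(* Let $p_1,\ldots,p_r\in\mathbb{R}[X_1,\ldots,X_n]$ and let $S=\{x\in\mathbb{R}^n\mid p_1(x)\ge 0,\ldots,p_r(x)\ge 0\}$ have non-empty interior. Let $a$ be a point in the boundary of $\overline{\operatorname{conv}(S)}$ that is also in $S$, and suppose that all active constraints at $a$ are singular, i.e. for every $i$ with $p_i(a)=0$ one has $\nabla p_i(a)=0$. Then for all $d$ the Lasserre relaxation $\mathscr{L}(\underline p)_d$ strictly contains $\overline{\operatorname{conv}(S)}$.
   Context: Write $\underline X=(X_1,\ldots,X_n)$, and let $\mathbb{R}[\underline X]_d$ be the space of real polynomials of degree at most $d$. For $\underline p=(p_1,\ldots,p_r)$ define the truncated quadratic module $\mathrm{QM}(\underline p)_d=\{\sigma_0+\sigma_1p_1+\cdots+\sigma_rp_r\mid \sigma_i\in\sum(\mathbb{R}[\underline X]_d)^2\}$, where $\sum(\mathbb{R}[\underline X]_d)^2$ is the set of finite sums of squares of elements of $\mathbb{R}[\underline X]_d$. The degree $d$ Lasserre relaxation is $\mathscr{L}(\underline p)_d=\{x\in\mathbb{R}^n\mid \ell(x)\ge 0 \text{ for all } \ell\in \mathrm{QM}(\underline p)_d\cap\mathbb{R}[\underline X]_1\}$. *)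

theory Defs
  imports "HOL-Analysis.Analysis" "HOL-Library.Poly_Mapping"
begin

text \<open>
  Real polynomials in the variables \<open>X\<^sub>i\<close>, \<open>i :: 'n\<close>, are the finitely supported functions from
  exponent vectors to coefficients; the ring structure (with convolution as multiplication) is
  that of Poly_Mapping.
\<close>

type_synonym 'n rpoly = "('n \<Rightarrow>\<^sub>0 nat) \<Rightarrow>\<^sub>0 real"

definition rpoly_eval :: "'n::finite rpoly \<Rightarrow> real ^ 'n \<Rightarrow> real" where
  "rpoly_eval p x =
     (\<Sum>m\<in>Poly_Mapping.keys p.
        Poly_Mapping.lookup p m * (\<Prod>i\<in>UNIV. (x $ i) ^ Poly_Mapping.lookup m i))"

definition rpolys_deg_le :: "nat \<Rightarrow> 'n::finite rpoly set" where
  "rpolys_deg_le d =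
     {p. \<forall>m\<in>Poly_Mapping.keys p. (\<Sum>i\<in>UNIV. Poly_Mapping.lookup m i) \<le> d}"

definition sums_of_squares :: "'a::comm_ring_1 set \<Rightarrow> 'a set" where
  "sums_of_squares A = {(\<Sum>q\<leftarrow>qs. q\<^sup>2) | qs. set qs \<subseteq> A}"

text \<open>
  Only the degrees of the polynomials
  being squared are bounded by \<open>d\<close>, not the degree of the resulting sum.  The constraints are
  \<open>p 1, \<dots>, p r\<close>; other values of \<open>p\<close> are irrelevant.
\<close>

definition trunc_quadratic_module :: "nat \<Rightarrow> (nat \<Rightarrow> 'n::finite rpoly) \<Rightarrow> nat \<Rightarrow> 'n rpoly set" where
  "trunc_quadratic_module r p d =
     {\<sigma> 0 + (\<Sum>i=1..r. \<sigma> i * p i) | \<sigma>. \<forall>i\<le>r. \<sigma> i \<in> sums_of_squares (rpolys_deg_le d)}"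

definition lasserre_relaxation :: "nat \<Rightarrow> (nat \<Rightarrow> 'n::finite rpoly) \<Rightarrow> nat \<Rightarrow> (real ^ 'n) set" where
  "lasserre_relaxation r p d =
     {x. \<forall>l \<in> trunc_quadratic_module r p d \<inter> rpolys_deg_le 1. rpoly_eval l x \<ge> 0}"

definition basic_closed_set :: "nat \<Rightarrow> (nat \<Rightarrow> 'n::finite rpoly) \<Rightarrow> (real ^ 'n) set" where
  "basic_closed_set r p = {x. \<forall>i\<in>{1..r}. rpoly_eval (p i) x \<ge> 0}"

end

theory Submission
  imports Defs "HOL-Computational_Algebra.Polynomial"
begin

text \<open>
  Let \<open>b\<close> be an interior point of \<open>S\<close> and \<open>v = b - a\<close>. For every \<open>\<epsilon> > 0\<close> the point
  \<open>a - \<epsilon>v\<close> lies outside the closed convex hull, and for small \<open>\<epsilon>\<close> it lies in the relaxation.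
  Indeed, an affine \<open>l = \<sigma>\<^sub>0 + \<Sum>\<sigma>\<^sub>i p\<^sub>i\<close> restricts to \<open>\<alpha> + \<beta>t\<close> on the line \<open>a + tv\<close>, where
  \<open>\<alpha> = l(a) \<ge> 0\<close>. Since \<open>p\<^sub>i \<ge> 0\<close> on that line near \<open>b\<close>, interpolation at finitely many points
  bounds the coefficients of the \<open>\<sigma>\<^sub>i\<close> along the line (for which \<open>p\<^sub>i\<close> does not vanish there) by a multiple
  of \<open>\<beta>\<close>. If \<open>\<alpha>\<close> were small compared to \<open>\<beta>\<close>, then so would be every \<open>\<sigma>\<^sub>i(a)\<close> with
  \<open>p\<^sub>i(a) > 0\<close>, and, as \<open>\<sigma>\<^sub>i \<ge> 0\<close>, the derivative of \<open>\<sigma>\<^sub>i\<close> along the line at \<open>a\<close>; the active constraints do not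
  contribute to the derivative \<open>\<beta>\<close> at all because they are singular, so \<open>\<beta>\<close> would be smaller than
  itself. This replaces the usual duality argument, which needs that the quadratic module
  is closed.
\<close>

section \<open>Bounds for univariate polynomials\<close>

text \<open>Quantitative interpolation: dividing out one node \<open>c\<close> lowers the degree,
  and the quotient takes bounded values on the other nodes. \<open>M\<close> depends on the nodes
  alone, hence serves all \<open>p\<close> at once.\<close>

lemma poly_coeffs_bounded_by_values:
  fixes A :: "real set"
  assumes "finite A" "card A = Suc n"
  shows "\<exists>M\<ge>0. \<forall>p B k. degree p \<le> n \<longrightarrow> (\<forall>x\<in>A. \<bar>poly p x\<bar> \<le> B) \<longrightarrow> \<bar>coeff p k\<bar> \<le> M * B"
  using assms
proof (induction n arbitrary: A)
  case 0
  then obtain x where A: "A = {x}"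
    by (auto simp: card_Suc_eq)
  have "\<bar>coeff p k\<bar> \<le> 1 * B" if "degree p \<le> 0" and B: "\<forall>x\<in>A. \<bar>poly p x\<bar> \<le> B" for p k B
  proof -
    have "degree p = 0"
      using that(1) by simp
    then obtain c where "p = [:c:]"
      by (rule degree_eq_zeroE)
    then show ?thesis
      using B A by (cases k) auto
  qed
  then show ?case
    by (intro exI[of _ 1]) auto
next
  case (Suc n)
  then obtain c A' where A: "A = insert c A'" "c \<notin> A'" "card A' = Suc n" "finite A'"
    by (metis card_Suc_eq finite_insert)
  obtain M where M: "M \<ge> 0"
    "\<forall>p B k. degree p \<le> n \<longrightarrow> (\<forall>x\<in>A'. \<bar>poly p x\<bar> \<le> B) \<longrightarrow> \<bar>coeff p k\<bar> \<le> M * B"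
    using Suc.IH[OF A(4,3)] by (elim exE conjE)
  define d where "d = Min ((\<lambda>x. \<bar>x - c\<bar>) ` A')"
  have "A' \<noteq> {}"
    using A(3) by auto
  then have d: "d > 0" "\<And>x. x \<in> A' \<Longrightarrow> d \<le> \<bar>x - c\<bar>"
    unfolding d_def using A by (auto simp: Min_gr_iff)
  \<comment> \<open>Read off from p = (x - c) u + p(c): the summand 1 pays for
    \<open>poly p c\<close>, the factor \<open>1 + \<bar>c\<bar>\<close> for two neighbouring
    coefficients of u.\<close>
  define M' where "M' = 1 + (1 + \<bar>c\<bar>) * (M * (2 / d))"
  have "\<bar>coeff p k\<bar> \<le> M' * B"
    if deg: "degree p \<le> Suc n" and B: "\<forall>x\<in>A. \<bar>poly p x\<bar> \<le> B" for p k B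
  proof -
    let ?u = "synthetic_div p c"
    have pc: "\<bar>poly p c\<bar> \<le> B"
      using B A by auto
    then have "B \<ge> 0"
      by linarith
    have u: "\<bar>coeff ?u j\<bar> \<le> M * (2 / d * B)" for j
    proof (rule M(2)[rule_format])
      show "degree ?u \<le> n"
        using deg by (simp add: degree_synthetic_div)
      fix x assume x: "x \<in> A'"
      have "poly p x = (x - c) * poly ?u x + poly p c"
        using arg_cong[OF synthetic_div_correct'[of c p], of "\<lambda>q. poly q x"]
        by (simp add: algebra_simps)
      then have "\<bar>x - c\<bar> * \<bar>poly ?u x\<bar> = \<bar>poly p x - poly p c\<bar>"
        by (simp add: abs_mult)
      also have "\<dots> \<le> 2 * B"
        using B A x pc by (smt (verit) insertCI)
      finally have "d * \<bar>poly ?u x\<bar> \<le> 2 * B"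
        by (smt (verit) d(2)[OF x] mult_right_mono abs_ge_zero)
      then show "\<bar>poly ?u x\<bar> \<le> 2 / d * B"
        using d(1) by (simp add: field_simps)
    qed
    have "coeff p k = (if k = 0 then poly p c else coeff ?u (k - 1)) - c * coeff ?u k"
      using arg_cong[OF synthetic_div_correct[of p c], of "\<lambda>q. coeff q k"]
      by (cases k) (auto simp: algebra_simps)
    then have "\<bar>coeff p k\<bar> \<le> \<bar>if k = 0 then poly p c else coeff ?u (k - 1)\<bar> + \<bar>c\<bar> * \<bar>coeff ?u k\<bar>"
      by (simp add: abs_mult[symmetric] abs_triangle_ineq4 del: abs_mult)
    also have "\<dots> \<le> (B + M * (2 / d * B)) + \<bar>c\<bar> * (M * (2 / d * B))"
    proof (intro add_mono mult_left_mono u abs_ge_zero)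
      have "0 \<le> M * (2 / d * B)"
        using M(1) d(1) \<open>B \<ge> 0\<close> by simp
      then show "\<bar>if k = 0 then poly p c else coeff ?u (k - 1)\<bar> \<le> B + M * (2 / d * B)"
        using u[of "k - 1"] pc \<open>B \<ge> 0\<close> by auto
    qed
    also have "\<dots> = M' * B"
      by (simp add: M'_def algebra_simps add_divide_distrib)
    finally show ?thesis .
  qed
  moreover have "M' \<ge> 0"
    unfolding M'_def using M(1) d(1) by simp
  ultimately show ?case
    by blast
qed

lemma abs_poly_le_coeff_bound:
  fixes p :: "real poly"
  assumes "degree p \<le> n" "\<And>k. \<bar>coeff p k\<bar> \<le> B" "\<bar>x\<bar> \<le> 1"
  shows "\<bar>poly p x\<bar> \<le> real (Suc n) * B"
proof -
  have "B \<ge> 0"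
    using assms(2)[of 0] by linarith
  have "\<bar>poly p x\<bar> \<le> (\<Sum>i\<le>degree p. \<bar>coeff p i * x ^ i\<bar>)"
    unfolding poly_altdef by (rule sum_abs)
  also have "\<dots> \<le> (\<Sum>i\<le>degree p. B)"
  proof (rule sum_mono)
    fix i
    have "\<bar>x\<bar> ^ i \<le> 1"
      using assms(3) by (simp add: power_le_one)
    then have "\<bar>coeff p i\<bar> * \<bar>x\<bar> ^ i \<le> B * 1"
      using assms(2) \<open>B \<ge> 0\<close> by (intro mult_mono) auto
    then show "\<bar>coeff p i * x ^ i\<bar> \<le> B"
      by (simp add: abs_mult power_abs)
  qed
  also have "\<dots> \<le> real (Suc n) * B"
    using assms(1) \<open>B \<ge> 0\<close> by (auto intro: mult_right_mono)
  finally show ?thesis .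
qed

text \<open>
  Nonnegativity at \<open>-\<tau>\<close> bounds the linear coefficient of \<open>s\<close> by
  \<open>s(0)/\<tau> + O(\<tau>)\<close>, which is \<open>O(\<tau>)\<close> since \<open>s(0) = O(\<tau>\<^sup>2)\<close>.
\<close>

lemma linear_coeff_weighted_nonneg_poly:
  fixes q :: "real poly" and T :: "real set"
  assumes "infinite T" "T \<subseteq> {0..1}" "\<And>t. t \<in> T \<Longrightarrow> poly q t \<ge> 0"
    and q0: "coeff q 0 \<ge> 0" and q1: "coeff q 0 = 0 \<Longrightarrow> coeff q 1 = 0"
  shows "\<exists>K\<ge>0. \<forall>s \<tau> \<beta>. degree s \<le> n \<longrightarrow> (\<forall>t. poly s t \<ge> 0) \<longrightarrow> 0 < \<tau> \<longrightarrow> \<tau> \<le> 1 \<longrightarrow> \<beta> > 0 \<longrightarrow>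
    (\<forall>t\<in>T. poly s t * poly q t \<le> 2 * \<beta>) \<longrightarrow> coeff s 0 * coeff q 0 \<le> \<tau>\<^sup>2 * \<beta> \<longrightarrow>
    coeff (s * q) 1 \<le> K * \<tau> * \<beta>"
proof (cases "coeff q 0 = 0")
  \<comment> \<open>This is the case of an active constraint: both low coefficients of
    \<open>q\<close> vanish, so \<open>s * q\<close> has no linear term, whatever \<open>s\<close>
    is.\<close>
  case True
  then show ?thesis
    using q1 by (intro exI[of _ 0]) (simp add: coeff_mult)
next
  case False
  then have "coeff q 0 > 0" "q \<noteq> 0"
    using q0 by auto
  \<comment> \<open>Discarding the finitely many roots of \<open>q\<close> leaves enough nodes, and
    on the chosen ones \<open>q\<close> is at least some \<open>m > 0\<close>, so bounds on
    \<open>s * q\<close> turn into bounds on \<open>s\<close>.\<close>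
  have "infinite (T - {t. poly q t = 0})"
    using assms(1) poly_roots_finite[OF \<open>q \<noteq> 0\<close>] by (simp add: Diff_infinite_finite)
  then obtain A where A: "finite A" "card A = Suc n" "A \<subseteq> T - {t. poly q t = 0}"
    using infinite_arbitrarily_large by blast
  then have "A \<noteq> {}"
    by auto
  define m where "m = Min (poly q ` A)"
  have "poly q t > 0" if "t \<in> A" for t
    using A(3) assms(3) that by (force simp: less_le)
  then have m: "m > 0" "\<And>t. t \<in> A \<Longrightarrow> m \<le> poly q t"
    unfolding m_def using A(1) \<open>A \<noteq> {}\<close> by (auto simp: Min_gr_iff)
  obtain M where M: "M \<ge> 0"
    "\<forall>p B k. degree p \<le> n \<longrightarrow> (\<forall>x\<in>A. \<bar>poly p x\<bar> \<le> B) \<longrightarrow> \<bar>coeff p k\<bar> \<le> M * B"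
    using poly_coeffs_bounded_by_values[OF A(1,2)] by (elim exE conjE)
  \<comment> \<open>\<open>L * \<beta>\<close> will bound \<open>u\<close> at
    \<open>- \<tau>\<close>, where s = c0 + c1 X + X^2 u.\<close>
  define L where "L = real (Suc n) * (M * (2 / m))"
  have L: "L \<ge> 0"
    unfolding L_def using M(1) m(1) by simp
  let ?q0 = "coeff q 0" and ?q1 = "coeff q 1"
  \<comment> \<open>The two summands of \<open>K\<close> bound the terms \<open>c1 * ?q0\<close> and
    \<open>c0 * ?q1\<close> of the linear coefficient of \<open>s * q\<close>.\<close>
  define K where "K = (1 / ?q0 + L) * ?q0 + 1 / ?q0 * \<bar>?q1\<bar>"
  have "coeff (s * q) 1 \<le> K * \<tau> * \<beta>"
    if s: "degree s \<le> n" "\<And>t. poly s t \<ge> 0" and \<tau>: "0 < \<tau>" "\<tau> \<le> 1" and "\<beta> > 0"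
      and T: "\<And>t. t \<in> T \<Longrightarrow> poly s t * poly q t \<le> 2 * \<beta>"
      and s0: "coeff s 0 * ?q0 \<le> \<tau>\<^sup>2 * \<beta>" for s \<tau> \<beta>
  proof -
    have cs: "\<bar>coeff s k\<bar> \<le> M * (2 / m * \<beta>)" for k
    proof (rule M(2)[rule_format, OF s(1)])
      fix t assume t: "t \<in> A"
      have "poly s t * m \<le> poly s t * poly q t"
        using m(2)[OF t] s(2) by (rule mult_left_mono)
      also have "\<dots> \<le> 2 * \<beta>"
        using T A(3) t by auto
      finally show "\<bar>poly s t\<bar> \<le> 2 / m * \<beta>"
        using s(2) m(1) by (simp add: field_simps)
    qed
    obtain c0 c1 u where su: "s = pCons c0 (pCons c1 u)"
      by (metis pCons_cases)
    have c: "coeff s 0 = c0" "coeff s 1 = c1"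
      by (simp_all add: su)
    have "degree u \<le> n"
      using s(1) by (auto simp: su split: if_splits)
    have "\<bar>poly u (- \<tau>)\<bar> \<le> real (Suc n) * (M * (2 / m * \<beta>))"
    proof (rule abs_poly_le_coeff_bound[OF \<open>degree u \<le> n\<close>])
      show "\<bar>coeff u k\<bar> \<le> M * (2 / m * \<beta>)" for k
        using cs[of "Suc (Suc k)"] by (simp add: su)
    qed (use \<tau> in auto)
    then have "poly u (- \<tau>) \<le> L * \<beta>"
      by (simp add: L_def algebra_simps)
    then have "\<tau>\<^sup>2 * poly u (- \<tau>) \<le> \<tau>\<^sup>2 * (L * \<beta>)"
      by (rule mult_left_mono) simp
    moreover have "0 \<le> c0 - \<tau> * c1 + \<tau>\<^sup>2 * poly u (- \<tau>)"
      using s(2)[of "- \<tau>"] by (simp add: su algebra_simps power2_eq_square)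
    moreover have c0: "c0 \<le> \<tau>\<^sup>2 * (1 / ?q0 * \<beta>)"
      using s0 \<open>?q0 > 0\<close> by (simp add: c field_simps)
    ultimately have "\<tau> * c1 \<le> \<tau> * (\<tau> * ((1 / ?q0 + L) * \<beta>))"
      by (simp add: algebra_simps power2_eq_square)
    then have "c1 \<le> \<tau> * ((1 / ?q0 + L) * \<beta>)"
      using \<tau>(1) by simp
    then have 1: "c1 * ?q0 \<le> \<tau> * ((1 / ?q0 + L) * \<beta>) * ?q0"
      using q0 by (rule mult_right_mono)
    have "c0 \<ge> 0"
      using s(2)[of 0] by (simp add: su)
    \<comment> \<open>Giving up one power of \<open>\<tau>\<close> puts both terms on the common
      scale \<open>\<tau> * \<beta>\<close>.\<close>
    have "\<tau>\<^sup>2 \<le> \<tau>"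
      using \<tau> by (simp add: power2_eq_square mult_left_le_one_le)
    then have "\<tau>\<^sup>2 * (1 / ?q0 * \<beta>) \<le> \<tau> * (1 / ?q0 * \<beta>)"
      using \<open>?q0 > 0\<close> \<open>\<beta> > 0\<close> by (intro mult_right_mono) auto
    then have "c0 \<le> \<tau> * (1 / ?q0 * \<beta>)"
      using c0 by linarith
    then have "c0 * \<bar>?q1\<bar> \<le> \<tau> * (1 / ?q0 * \<beta>) * \<bar>?q1\<bar>"
      by (rule mult_right_mono) simp
    moreover have "c0 * ?q1 \<le> c0 * \<bar>?q1\<bar>"
      using \<open>c0 \<ge> 0\<close> by (intro mult_left_mono) auto
    ultimately have 2: "c0 * ?q1 \<le> \<tau> * (1 / ?q0 * \<beta>) * \<bar>?q1\<bar>"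
      by linarith
    have "coeff (s * q) 1 = c1 * ?q0 + c0 * ?q1"
      by (simp add: coeff_mult su)
    also have "\<dots> \<le> \<tau> * ((1 / ?q0 + L) * \<beta>) * ?q0 + \<tau> * (1 / ?q0 * \<beta>) * \<bar>?q1\<bar>"
      using 1 2 by (rule add_mono)
    also have "\<dots> = K * \<tau> * \<beta>"
      unfolding K_def by (simp only: algebra_simps)
    finally show ?thesis .
  qed
  moreover have "K \<ge> 0"
    unfolding K_def using L \<open>?q0 > 0\<close> by simp
  ultimately show ?thesis
    by blast
qed

text \<open>If \<alpha> were at most \<tau>^2 \<beta>, each product \<open>s i * q i\<close>, being
  one of several nonnegative summands of \<alpha> + \<beta> t on \<open>T\<close>, would be at most
  2 \<beta> there. The preceding lemma then makes all linear coefficients small, although they add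
  up to \<beta>. The bound is uniform in \<open>s\<close>, so one \<epsilon> serves every element of
  the quadratic module.\<close>

lemma affine_combination_nonneg_polys_bound:
  fixes q :: "'i \<Rightarrow> real poly" and T :: "real set"
  assumes "finite I" and T: "infinite T" "T \<subseteq> {0..1}"
    and qT: "\<And>i t. i \<in> I \<Longrightarrow> t \<in> T \<Longrightarrow> poly (q i) t \<ge> 0"
    and q0: "\<And>i. i \<in> I \<Longrightarrow> coeff (q i) 0 \<ge> 0"
    and q1: "\<And>i. i \<in> I \<Longrightarrow> coeff (q i) 0 = 0 \<Longrightarrow> coeff (q i) 1 = 0"
  obtains \<epsilon> where "\<epsilon> > 0"
    "\<And>s \<alpha> \<beta>. (\<And>i. i \<in> I \<Longrightarrow> degree (s i) \<le> n) \<Longrightarrow> (\<And>i t. i \<in> I \<Longrightarrow> poly (s i) t \<ge> 0) \<Longrightarrow>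
      (\<Sum>i\<in>I. s i * q i) = [:\<alpha>, \<beta>:] \<Longrightarrow> \<beta> > 0 \<Longrightarrow> \<alpha> > \<epsilon> * \<beta>"
proof -
  have "\<forall>i\<in>I. \<exists>K\<ge>0. \<forall>s \<tau> \<beta>. degree s \<le> n \<longrightarrow> (\<forall>t. poly s t \<ge> 0) \<longrightarrow> 0 < \<tau> \<longrightarrow> \<tau> \<le> 1 \<longrightarrow>
    \<beta> > 0 \<longrightarrow> (\<forall>t\<in>T. poly s t * poly (q i) t \<le> 2 * \<beta>) \<longrightarrow>
    coeff s 0 * coeff (q i) 0 \<le> \<tau>\<^sup>2 * \<beta> \<longrightarrow> coeff (s * q i) 1 \<le> K * \<tau> * \<beta>"
    using linear_coeff_weighted_nonneg_poly[OF T qT q0 q1] by blast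
  then obtain K where K: "\<And>i. i \<in> I \<Longrightarrow> K i \<ge> (0::real)"
    "\<And>i s \<tau> \<beta>. i \<in> I \<Longrightarrow> degree s \<le> n \<Longrightarrow> (\<And>t. poly s t \<ge> 0) \<Longrightarrow> 0 < \<tau> \<Longrightarrow> \<tau> \<le> 1 \<Longrightarrow>
      \<beta> > 0 \<Longrightarrow> (\<And>t. t \<in> T \<Longrightarrow> poly s t * poly (q i) t \<le> 2 * \<beta>) \<Longrightarrow>
      coeff s 0 * coeff (q i) 0 \<le> \<tau>\<^sup>2 * \<beta> \<Longrightarrow> coeff (s * q i) 1 \<le> K i * \<tau> * \<beta>"
    by metis
  define C where "C = (\<Sum>i\<in>I. K i)"
  have "C \<ge> 0"
    unfolding C_def by (intro sum_nonneg K(1))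
  \<comment> \<open>Small enough for \<open>C * \<tau> < 1\<close>, which gives the contradiction;
    the \<epsilon> obtained is \<open>\<tau>\<^sup>2\<close>.\<close>
  define \<tau> where "\<tau> = 1 / (C + 1)"
  have \<tau>: "0 < \<tau>" "\<tau> \<le> 1" "C * \<tau> < 1"
    unfolding \<tau>_def using \<open>C \<ge> 0\<close> by auto
  have "\<alpha> > \<tau>\<^sup>2 * \<beta>"
    if deg: "\<And>i. i \<in> I \<Longrightarrow> degree (s i) \<le> n" and nn: "\<And>i t. i \<in> I \<Longrightarrow> poly (s i) t \<ge> 0"
      and eq: "(\<Sum>i\<in>I. s i * q i) = [:\<alpha>, \<beta>:]" and "\<beta> > 0" for s \<alpha> \<beta>
  proof (rule ccontr)
    assume "\<not> \<alpha> > \<tau>\<^sup>2 * \<beta>"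
    then have \<alpha>: "\<alpha> \<le> \<tau>\<^sup>2 * \<beta>"
      by simp
    also have "\<dots> \<le> 1 * \<beta>"
      using \<tau> \<open>\<beta> > 0\<close> by (intro mult_right_mono) (auto simp: power_le_one)
    finally have "\<alpha> \<le> \<beta>"
      by simp
    have "coeff (s i * q i) 1 \<le> K i * \<tau> * \<beta>" if i: "i \<in> I" for i
    proof (rule K(2)[OF i deg[OF i] nn[OF i] \<tau>(1,2) \<open>\<beta> > 0\<close>])
      fix t assume t: "t \<in> T"
      have "poly (s i) t * poly (q i) t \<le> (\<Sum>j\<in>I. poly (s j) t * poly (q j) t)"
        using \<open>finite I\<close> nn qT t i by (intro member_le_sum) auto
      also have "\<dots> = \<alpha> + t * \<beta>"
        using arg_cong[OF eq, of "\<lambda>p. poly p t"] by (simp add: poly_sum)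
      also have "\<dots> \<le> 2 * \<beta>"
      proof -
        have "t \<le> 1"
          using T(2) t by auto
        then have "t * \<beta> \<le> 1 * \<beta>"
          using \<open>\<beta> > 0\<close> by (intro mult_right_mono) auto
        then show ?thesis
          using \<open>\<alpha> \<le> \<beta>\<close> by simp
      qed
      finally show "poly (s i) t * poly (q i) t \<le> 2 * \<beta>" .
    next
      have s0: "coeff (s j) 0 \<ge> 0" if "j \<in> I" for j
        using nn[OF that, of 0] by (simp add: poly_0_coeff_0)
      have "coeff (s i) 0 * coeff (q i) 0 \<le> (\<Sum>j\<in>I. coeff (s j) 0 * coeff (q j) 0)"
        using \<open>finite I\<close> s0 q0 i by (intro member_le_sum) auto
      also have "\<dots> = \<alpha>"
        using arg_cong[OF eq, of "\<lambda>p. coeff p 0"] by (simp add: coeff_sum coeff_mult)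
      finally show "coeff (s i) 0 * coeff (q i) 0 \<le> \<tau>\<^sup>2 * \<beta>"
        using \<alpha> by simp
    qed
    then have "(\<Sum>i\<in>I. coeff (s i * q i) 1) \<le> (\<Sum>i\<in>I. K i * \<tau> * \<beta>)"
      by (rule sum_mono)
    moreover have "(\<Sum>i\<in>I. coeff (s i * q i) 1) = \<beta>"
      using arg_cong[OF eq, of "\<lambda>p. coeff p 1"] by (simp add: coeff_sum)
    moreover have "(\<Sum>i\<in>I. K i * \<tau> * \<beta>) = C * \<tau> * \<beta>"
      by (simp add: C_def sum_distrib_right)
    moreover have "C * \<tau> * \<beta> < 1 * \<beta>"
      using \<tau>(3) \<open>\<beta> > 0\<close> by (rule mult_strict_right_mono)
    ultimately show False
      by simp
  qed
  then show thesis
    using that \<tau>(1) zero_less_power by blast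
qed

section \<open>Restriction of polynomials to lines\<close>

definition monomial_on_line :: "real ^ 'n \<Rightarrow> real ^ 'n \<Rightarrow> ('n::finite \<Rightarrow>\<^sub>0 nat) \<Rightarrow> real poly" where
  "monomial_on_line a v m = (\<Prod>i\<in>UNIV. [:a $ i, v $ i:] ^ Poly_Mapping.lookup m i)"

text \<open>The pullback along t -> a + t v is kept as a formal polynomial, so that degrees and
  coefficients are available besides values.\<close>

definition rpoly_on_line :: "real ^ 'n \<Rightarrow> real ^ 'n \<Rightarrow> 'n::finite rpoly \<Rightarrow> real poly" where
  "rpoly_on_line a v p =
     (\<Sum>m\<in>Poly_Mapping.keys p. smult (Poly_Mapping.lookup p m) (monomial_on_line a v m))"

lemma poly_rpoly_on_line: "poly (rpoly_on_line a v p) t = rpoly_eval p (a + t *\<^sub>R v)"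
  by (simp add: rpoly_on_line_def monomial_on_line_def rpoly_eval_def poly_sum poly_prod)

text \<open>Cancellation can shrink the support of a sum; a common index set allows termwise
  comparison.\<close>

lemma rpoly_on_line_superset:
  assumes "finite A" "Poly_Mapping.keys p \<subseteq> A"
  shows "rpoly_on_line a v p =
    (\<Sum>m\<in>A. smult (Poly_Mapping.lookup p m) (monomial_on_line a v m))"
  unfolding rpoly_on_line_def
  using assms by (intro sum.mono_neutral_left) (auto simp: in_keys_iff)

lemma rpoly_on_line_add:
  "rpoly_on_line a v (p + q) = rpoly_on_line a v p + rpoly_on_line a v q"
proof -
  let ?A = "Poly_Mapping.keys p \<union> Poly_Mapping.keys q"
  have "rpoly_on_line a v f = (\<Sum>m\<in>?A. smult (Poly_Mapping.lookup f m) (monomial_on_line a v m))"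
    if "f \<in> {p, q, p + q}" for f
    using that keys_add[of p q] by (intro rpoly_on_line_superset) auto
  then show ?thesis
    by (simp add: lookup_add smult_add_left sum.distrib)
qed

lemma rpoly_on_line_0 [simp]: "rpoly_on_line a v 0 = 0"
  by (simp add: rpoly_on_line_def)

lemma rpoly_on_line_sum: "rpoly_on_line a v (\<Sum>i\<in>I. f i) = (\<Sum>i\<in>I. rpoly_on_line a v (f i))"
  by (induction I rule: infinite_finite_induct) (simp_all add: rpoly_on_line_add)

lemma rpoly_on_line_single:
  "rpoly_on_line a v (Poly_Mapping.single m c) = smult c (monomial_on_line a v m)"
  by (cases "c = 0") (simp_all add: rpoly_on_line_def)

lemma rpoly_sum_of_monomials:
  "p = (\<Sum>m\<in>Poly_Mapping.keys p. Poly_Mapping.single m (Poly_Mapping.lookup p m))"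
proof (rule poly_mapping_eqI)
  fix k
  have "(\<Sum>m\<in>Poly_Mapping.keys p. Poly_Mapping.lookup p m when m = k) =
      (\<Sum>m\<in>Poly_Mapping.keys p. if m = k then Poly_Mapping.lookup p m else 0)"
    by (intro sum.cong) (auto simp: when_def)
  also have "\<dots> = Poly_Mapping.lookup p k"
    by (simp add: in_keys_iff)
  finally show "Poly_Mapping.lookup p k = Poly_Mapping.lookup
      (\<Sum>m\<in>Poly_Mapping.keys p. Poly_Mapping.single m (Poly_Mapping.lookup p m)) k"
    by (simp add: lookup_sum lookup_single)
qed

lemma monomial_on_line_add:
  "monomial_on_line a v (m + m') = monomial_on_line a v m * monomial_on_line a v m'"
  by (simp add: monomial_on_line_def lookup_add power_add prod.distrib)

lemma rpoly_on_line_mult: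
  "rpoly_on_line a v (p * q) = rpoly_on_line a v p * rpoly_on_line a v q"
proof -
  let ?P = "Poly_Mapping.keys p" and ?Q = "Poly_Mapping.keys q"
  have "p * q = (\<Sum>m\<in>?P. \<Sum>m'\<in>?Q.
      Poly_Mapping.single (m + m') (Poly_Mapping.lookup p m * Poly_Mapping.lookup q m'))"
    by (subst rpoly_sum_of_monomials[of p], subst rpoly_sum_of_monomials[of q])
       (simp add: sum_product mult_single)
  then have "rpoly_on_line a v (p * q) = (\<Sum>m\<in>?P. \<Sum>m'\<in>?Q.
      smult (Poly_Mapping.lookup p m * Poly_Mapping.lookup q m')
        (monomial_on_line a v m * monomial_on_line a v m'))"
    by (simp add: rpoly_on_line_sum rpoly_on_line_single monomial_on_line_add)
  also have "\<dots> = rpoly_on_line a v p * rpoly_on_line a v q"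
    by (simp add: rpoly_on_line_def sum_product mult.commute)
  finally show ?thesis .
qed

section \<open>Degrees and signs of restrictions to a line\<close>

lemma degree_rpoly_on_line_le:
  assumes "p \<in> rpolys_deg_le d"
  shows "degree (rpoly_on_line a v p) \<le> d"
  unfolding rpoly_on_line_def
proof (rule degree_sum_le)
  fix m assume m: "m \<in> Poly_Mapping.keys p"
  have "degree (monomial_on_line a v m) \<le>
      (\<Sum>i\<in>UNIV. (degree \<circ> (\<lambda>i. [:a $ i, v $ i:] ^ Poly_Mapping.lookup m i)) i)"
    unfolding monomial_on_line_def by (rule degree_prod_sum_le) simp
  also have "\<dots> \<le> (\<Sum>i\<in>UNIV. Poly_Mapping.lookup m i)"
    by (intro sum_mono) (auto intro!: order.trans[OF degree_power_le])
  also have "\<dots> \<le> d"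
    using assms m by (simp add: rpolys_deg_le_def)
  finally show "degree (smult (Poly_Mapping.lookup p m) (monomial_on_line a v m)) \<le> d"
    by (rule order.trans[OF degree_smult_le])
qed simp

text \<open>The bound is \<open>2 * d\<close> because \<open>d\<close> limits the polynomials being
  squared. Nonnegativity holds on the whole line, also at negative parameters, where the constraints
  may fail.\<close>

lemma sums_of_squares_on_line:
  assumes "\<sigma> \<in> sums_of_squares (rpolys_deg_le d)"
  shows "degree (rpoly_on_line a v \<sigma>) \<le> 2 * d" "poly (rpoly_on_line a v \<sigma>) t \<ge> 0"
proof -
  obtain qs where \<sigma>: "\<sigma> = (\<Sum>q\<leftarrow>qs. q\<^sup>2)" and qs: "set qs \<subseteq> rpolys_deg_le d"
    using assms by (auto simp: sums_of_squares_def)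
  have "degree (rpoly_on_line a v (\<Sum>q\<leftarrow>qs. q\<^sup>2)) \<le> 2 * d \<and>
      poly (rpoly_on_line a v (\<Sum>q\<leftarrow>qs. q\<^sup>2)) t \<ge> 0"
    using qs
  proof (induction qs)
    case (Cons q qs)
    have "degree (rpoly_on_line a v (q\<^sup>2)) \<le> degree (rpoly_on_line a v q) + degree (rpoly_on_line a v q)"
      unfolding power2_eq_square rpoly_on_line_mult by (rule degree_mult_le)
    also have "\<dots> \<le> 2 * d"
      using degree_rpoly_on_line_le[of q d a v] Cons.prems by auto
    finally show ?case
      using Cons by (auto simp: rpoly_on_line_add intro!: degree_add_le add_nonneg_nonneg)
        (simp add: power2_eq_square rpoly_on_line_mult)
  qed simp
  then show "degree (rpoly_on_line a v \<sigma>) \<le> 2 * d" "poly (rpoly_on_line a v \<sigma>) t \<ge> 0"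
    by (simp_all add: \<sigma>)
qed

text \<open>The weight 1 at index 0 treats the free sum of squares like the others, giving a single
  sum over \<open>{..r}\<close>.\<close>

lemma trunc_quadratic_module_on_line:
  assumes "l \<in> trunc_quadratic_module r p d"
  obtains s where "\<forall>i\<le>r. degree (s i) \<le> 2 * d" "\<forall>i\<le>r. \<forall>t. poly (s i) t \<ge> 0"
    "rpoly_on_line a v l = (\<Sum>i\<le>r. s i * (if i = 0 then 1 else rpoly_on_line a v (p i)))"
proof -
  obtain \<sigma> where l: "l = \<sigma> 0 + (\<Sum>i=1..r. \<sigma> i * p i)"
    and \<sigma>: "\<And>i. i \<le> r \<Longrightarrow> \<sigma> i \<in> sums_of_squares (rpolys_deg_le d)"
    using assms by (auto simp: trunc_quadratic_module_def)
  have "{..r} = insert 0 {1..r}"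
    by auto
  then have "rpoly_on_line a v l =
      (\<Sum>i\<le>r. rpoly_on_line a v (\<sigma> i) * (if i = 0 then 1 else rpoly_on_line a v (p i)))"
    by (simp add: l rpoly_on_line_add rpoly_on_line_sum rpoly_on_line_mult)
  then show thesis
    using that[of "\<lambda>i. rpoly_on_line a v (\<sigma> i)"] sums_of_squares_on_line[OF \<sigma>] by blast
qed

section \<open>Lasserre relaxations\<close>

text \<open>Evaluation at \<open>x\<close> is restriction to the degenerate line with direction 0,
  so its compatibility with sums and products comes from that of restriction.\<close>

lemma basic_closed_set_subset_lasserre: "basic_closed_set r p \<subseteq> lasserre_relaxation r p d"
proof
  fix x assume x: "x \<in> basic_closed_set r p"
  have "rpoly_eval l x \<ge> 0" if l: "l \<in> trunc_quadratic_module r p d" for l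
  proof -
    obtain s where "\<forall>i\<le>r. degree (s i) \<le> 2 * d" and s: "\<forall>i\<le>r. \<forall>t. poly (s i) t \<ge> 0"
      "rpoly_on_line x 0 l = (\<Sum>i\<le>r. s i * (if i = 0 then 1 else rpoly_on_line x 0 (p i)))"
      by (rule trunc_quadratic_module_on_line[OF l])
    have "rpoly_eval l x = poly (rpoly_on_line x 0 l) 0"
      by (simp add: poly_rpoly_on_line)
    also have "\<dots> = (\<Sum>i\<le>r. poly (s i) 0 * (if i = 0 then 1 else rpoly_eval (p i) x))"
      unfolding s(2) by (auto simp: poly_sum poly_rpoly_on_line intro!: sum.cong)
    also have "\<dots> \<ge> 0"
      using s(1) x by (intro sum_nonneg) (auto simp: basic_closed_set_def)
    finally show ?thesis .
  qed
  then show "x \<in> lasserre_relaxation r p d"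
    by (auto simp: lasserre_relaxation_def)
qed

section \<open>Closedness and convexity of the relaxation\<close>

lemma continuous_rpoly_eval: "continuous_on A (rpoly_eval p)"
  unfolding rpoly_eval_def[abs_def] by (intro continuous_intros)

lemma affine_on_line:
  assumes "l \<in> rpolys_deg_le 1"
  obtains \<alpha> \<beta> where "rpoly_on_line a v l = [:\<alpha>, \<beta>:]"
proof -
  have deg: "degree (rpoly_on_line a v l) \<le> 1"
    by (rule degree_rpoly_on_line_le[OF assms])
  have "rpoly_on_line a v l = [:coeff (rpoly_on_line a v l) 0, coeff (rpoly_on_line a v l) 1:]"
    using deg by (auto simp: poly_eq_iff coeff_pCons coeff_eq_0 split: nat.splits)
  then show thesis
    by (rule that)
qed

lemma closed_lasserre_relaxation: "closed (lasserre_relaxation r p d)"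
proof -
  have "lasserre_relaxation r p d =
      (\<Inter>l\<in>trunc_quadratic_module r p d \<inter> rpolys_deg_le 1. {x. 0 \<le> rpoly_eval l x})"
    by (auto simp: lasserre_relaxation_def)
  then show ?thesis
    by (auto intro!: closed_INT closed_Collect_le continuous_rpoly_eval continuous_intros)
qed

lemma convex_lasserre_relaxation: "convex (lasserre_relaxation r p d)"
  unfolding convex_alt
proof (intro ballI allI impI)
  fix x y and u :: real
  assume xy: "x \<in> lasserre_relaxation r p d" "y \<in> lasserre_relaxation r p d" and u: "0 \<le> u \<and> u \<le> 1"
  have "rpoly_eval l ((1 - u) *\<^sub>R x + u *\<^sub>R y) \<ge> 0"
    if l: "l \<in> trunc_quadratic_module r p d" "l \<in> rpolys_deg_le 1" for l
  proof -
    obtain \<alpha> \<beta> where "rpoly_on_line x (y - x) l = [:\<alpha>, \<beta>:]"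
      using affine_on_line[OF l(2)] .
    then have ev: "rpoly_eval l (x + t *\<^sub>R (y - x)) = \<alpha> + t * \<beta>" for t
      using poly_rpoly_on_line[of x "y - x" l t] by simp
    have "rpoly_eval l x \<ge> 0" "rpoly_eval l y \<ge> 0"
      using xy l unfolding lasserre_relaxation_def by blast+
    then have "\<alpha> \<ge> 0" "\<alpha> + \<beta> \<ge> 0"
      using ev[of 0] ev[of 1] by simp_all
    then have "0 \<le> (1 - u) * \<alpha> + u * (\<alpha> + \<beta>)"
      using u by simp
    also have "\<dots> = rpoly_eval l (x + u *\<^sub>R (y - x))"
      unfolding ev by argo
    also have "x + u *\<^sub>R (y - x) = (1 - u) *\<^sub>R x + u *\<^sub>R y"
      by (simp add: algebra_simps)
    finally show ?thesis .
  qed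
  then show "(1 - u) *\<^sub>R x + u *\<^sub>R y \<in> lasserre_relaxation r p d"
    by (auto simp: lasserre_relaxation_def)
qed

text \<open>By the chain rule the linear coefficient is the derivative of \<open>q\<close> at
  \<open>a\<close> in direction \<open>v\<close>.\<close>

lemma linear_coeff_on_line_singular:
  assumes "GDERIV (rpoly_eval q) a :> 0"
  shows "coeff (rpoly_on_line a v q) 1 = 0"
proof -
  have "(rpoly_eval q has_derivative (\<lambda>h. 0)) (at (a + 0 *\<^sub>R v))"
    using assms by (simp add: gderiv_def)
  moreover have "((\<lambda>t. a + t *\<^sub>R v) has_derivative (\<lambda>t. t *\<^sub>R v)) (at 0)"
    by (auto intro!: derivative_eq_intros)
  ultimately have "((\<lambda>t. rpoly_eval q (a + t *\<^sub>R v)) has_derivative (\<lambda>t. 0)) (at 0)"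
    using has_derivative_compose[of "\<lambda>t. a + t *\<^sub>R v" _ 0 UNIV "rpoly_eval q" "\<lambda>h. 0"] by simp
  then have "(poly (rpoly_on_line a v q) has_field_derivative 0) (at 0)"
    unfolding has_field_derivative_def poly_rpoly_on_line[abs_def] mult_zero_left .
  then have "poly (pderiv (rpoly_on_line a v q)) 0 = 0"
    using poly_DERIV DERIV_unique by blast
  then show ?thesis
    by (simp add: poly_0_coeff_0 coeff_pderiv)
qed

section \<open>A point of the relaxation outside the closed convex hull\<close>

theorem theorem4p3:
  fixes p :: "nat \<Rightarrow> 'n::finite rpoly"
    and r :: nat
    and S :: "(real ^ 'n) set"
    and a :: "real ^ 'n"
  assumes S_def: "S = basic_closed_set r p"
    and int: "interior S \<noteq> {}"
    and bd: "a \<in> frontier (closure (convex hull S))"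
    and aS: "a \<in> S"
    and sing: "\<And>i. i \<in> {1..r} \<Longrightarrow> rpoly_eval (p i) a = 0 \<Longrightarrow>
                 GDERIV (rpoly_eval (p i)) a :> 0"
  shows "\<forall>d. closure (convex hull S) \<subset> lasserre_relaxation r p d"
proof
  fix d
  let ?C = "closure (convex hull S)" and ?L = "lasserre_relaxation r p d"
  have "S \<subseteq> ?L"
    unfolding S_def by (rule basic_closed_set_subset_lasserre)
  then have sub: "?C \<subseteq> ?L"
    by (intro closure_minimal hull_minimal convex_lasserre_relaxation closed_lasserre_relaxation)
  have SC: "S \<subseteq> ?C"
    by (meson closure_subset hull_subset subset_trans)
  obtain b where b: "b \<in> interior S"
    using int by blast
  have a: "a \<notin> interior ?C"
    using bd by (simp add: frontier_def)
  have bC: "b \<in> interior ?C"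
    using b interior_mono[OF SC] by blast
  define v where "v = b - a"
  \<comment> \<open>Otherwise \<open>a\<close> would lie strictly between a point of
    \<open>?C\<close> and the interior point \<open>b\<close>, and so be interior itself.\<close>
  have outside: "a - \<epsilon> *\<^sub>R v \<notin> ?C" if "\<epsilon> > 0" for \<epsilon> :: real
  proof
    assume x: "a - \<epsilon> *\<^sub>R v \<in> ?C"
    \<comment> \<open>With x = a - \<epsilon> v one has b - x = (1 + \<epsilon>) v, so
      \<open>a\<close> divides the segment from x to b in the ratio
      \<open>\<epsilon> / (1 + \<epsilon>)\<close>.\<close>
    have "\<epsilon> / (1 + \<epsilon>) * (1 + \<epsilon>) = \<epsilon>"
      using that by simp
    then have "\<epsilon> *\<^sub>R v = (\<epsilon> / (1 + \<epsilon>)) *\<^sub>R ((1 + \<epsilon>) *\<^sub>R v)"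
      by (simp only: scaleR_scaleR)
    moreover have "(1 + \<epsilon>) *\<^sub>R v = b - (a - \<epsilon> *\<^sub>R v)"
      by (simp add: v_def algebra_simps)
    ultimately have "a = (a - \<epsilon> *\<^sub>R v) - (\<epsilon> / (1 + \<epsilon>)) *\<^sub>R ((a - \<epsilon> *\<^sub>R v) - b)"
      by (smt (verit) minus_diff_eq scaleR_minus_right diff_minus_eq_add diff_add_cancel)
    moreover have "(a - \<epsilon> *\<^sub>R v) - (\<epsilon> / (1 + \<epsilon>)) *\<^sub>R ((a - \<epsilon> *\<^sub>R v) - b) \<in> interior ?C"
      using that x by (intro mem_interior_closure_convex_shrink bC) (auto simp: convex_closure)
    ultimately show False
      using a by metis
  qed
  define q where "q = (\<lambda>i::nat. if i = 0 then 1 else rpoly_on_line a v (p i))"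
  define T where "T = {t \<in> {0..1}. a + t *\<^sub>R v \<in> S}"
  \<comment> \<open>The parameter 1 gives \<open>b\<close>, so all parameters slightly below 1 stay
    in the interior of \<open>S\<close>.\<close>
  have "infinite T"
  proof -
    have "isCont (\<lambda>t. a + t *\<^sub>R v) 1"
      by (intro continuous_intros)
    moreover have "a + 1 *\<^sub>R v \<in> interior S"
      using b by (simp add: v_def)
    ultimately have "eventually (\<lambda>t. a + t *\<^sub>R v \<in> interior S) (nhds 1)"
      using isCont_def tendsto_def open_interior eventually_nhds_conv_at by metis
    then obtain \<delta> where \<delta>: "\<delta> > 0" "\<And>t. \<bar>t - 1\<bar> < \<delta> \<Longrightarrow> a + t *\<^sub>R v \<in> interior S"
      by (auto simp: eventually_nhds_metric dist_real_def)
    have "{max 0 (1 - \<delta>)<..<1} \<subseteq> T"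
      using \<delta>(2) interior_subset[of S] by (fastforce simp: T_def)
    moreover have "infinite {max 0 (1 - \<delta>)<..<1}"
      using \<delta>(1) by (intro infinite_Ioo) auto
    ultimately show ?thesis
      by (rule infinite_super)
  qed
  have q_nonneg: "poly (q i) t \<ge> 0" if "i \<le> r" "a + t *\<^sub>R v \<in> S" for i t
    using that by (auto simp: q_def poly_rpoly_on_line S_def basic_closed_set_def)
  \<comment> \<open>This \<epsilon> is fixed before any \<open>l\<close> is chosen, so a single
    point can be tested against all \<open>l\<close>.\<close>
  obtain \<epsilon> where \<epsilon>: "\<epsilon> > 0"
    "\<And>s \<alpha> \<beta>. (\<And>i. i \<in> {..r} \<Longrightarrow> degree (s i) \<le> 2 * d) \<Longrightarrow>
      (\<And>i t. i \<in> {..r} \<Longrightarrow> poly (s i) t \<ge> 0) \<Longrightarrow>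
      (\<Sum>i\<in>{..r}. s i * q i) = [:\<alpha>, \<beta>:] \<Longrightarrow> \<beta> > 0 \<Longrightarrow> \<alpha> > \<epsilon> * \<beta>"
  proof (rule affine_combination_nonneg_polys_bound[of "{..r}" T q "2 * d"])
    fix i assume i: "i \<in> {..r}"
    show "coeff (q i) 0 \<ge> 0"
      using q_nonneg[of i 0] i aS by (simp add: poly_0_coeff_0)
    assume "coeff (q i) 0 = 0"
    \<comment> \<open>\<open>q 0\<close> is 1, so a vanishing constant coefficient means a
      constraint active at \<open>a\<close>, which is singular by assumption.\<close>
    then have "i \<noteq> 0" "rpoly_eval (p i) a = 0"
      using poly_rpoly_on_line[of a v "p i" 0] by (auto simp: q_def poly_0_coeff_0 split: if_splits)
    then show "coeff (q i) 1 = 0"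
      using linear_coeff_on_line_singular[OF sing[of i]] i by (simp add: q_def)
  qed (use \<open>infinite T\<close> q_nonneg in \<open>auto simp: T_def\<close>)
  have "a - \<epsilon> *\<^sub>R v \<in> ?L"
    unfolding lasserre_relaxation_def
  proof (intro CollectI ballI, elim IntE)
    fix l assume l: "l \<in> trunc_quadratic_module r p d" "l \<in> rpolys_deg_le 1"
    obtain \<alpha> \<beta> where l\<alpha>\<beta>: "rpoly_on_line a v l = [:\<alpha>, \<beta>:]"
      using affine_on_line[OF l(2)] .
    obtain s where s: "\<forall>i\<le>r. degree (s i) \<le> 2 * d" "\<forall>i\<le>r. \<forall>t. poly (s i) t \<ge> 0"
      and "rpoly_on_line a v l = (\<Sum>i\<le>r. s i * (if i = 0 then 1 else rpoly_on_line a v (p i)))"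
      by (rule trunc_quadratic_module_on_line[OF l(1)])
    then have ls: "(\<Sum>i\<le>r. s i * q i) = [:\<alpha>, \<beta>:]"
      by (simp add: q_def l\<alpha>\<beta>)
    have "\<alpha> = rpoly_eval l a"
      using poly_rpoly_on_line[of a v l 0] by (simp add: l\<alpha>\<beta>)
    then have "\<alpha> \<ge> 0"
      using \<open>S \<subseteq> ?L\<close> aS l by (auto simp: lasserre_relaxation_def)
    \<comment> \<open>The value of \<open>l\<close> at \<open>a - \<epsilon> *\<^sub>R v\<close> is
      \<alpha> - \<epsilon> \<beta>. Only an \<open>l\<close> increasing towards \<open>b\<close>
      needs the uniform bound.\<close>
    have "\<alpha> \<ge> \<epsilon> * \<beta>"
    proof (cases "\<beta> > 0")
      case True
      then show ?thesis
        using \<epsilon>(2)[of s \<alpha> \<beta>] s ls by auto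
    next
      case False
      then show ?thesis
        using \<open>\<alpha> \<ge> 0\<close> \<epsilon>(1) mult_nonneg_nonpos[of \<epsilon> \<beta>] by linarith
    qed
    then show "rpoly_eval l (a - \<epsilon> *\<^sub>R v) \<ge> 0"
      using poly_rpoly_on_line[of a v l "- \<epsilon>"] by (simp add: l\<alpha>\<beta>)
  qed
  then show "?C \<subset> ?L"
    using sub outside[OF \<epsilon>(1)] by blast
qed

end
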